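(* Let $g(s)=\sum_pb_pp^{-s}$ (sum over the primes $p$) be any linear symbol in $\mathcal{H}^2$. Then $\|\mathbf{T}_g\|=\|g\|_{\mathcal{H}^2}$, where $\|\mathbf{T}_g\|$ is the operator norm of $\mathbf{T}_g$ on $\mathcal{H}^2$.
   Context: $\mathcal{H}^2$ is the Hilbert space of Dirichlet series $f(s)=\sum_{n\ge1}a_nn^{-s}$ with $\|f\|_{\mathcal{H}^2}^2=\sum_{n\ge1}|a_n|^2<\infty$. The Volterra operator with symbol $g$ is $\mathbf{T}_gf(s)=-\int_s^{+\infty}f(w)g'(w)\,dw$ (integral along the horizontal half-line from $s$, $\mathrm{Re}\,s>1/2$), which is again a Dirichlet series. A linear symbol is a Dirichlet series with non-zero coefficients only at the primes. *)

theory Defs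
  imports "HOL-Analysis.Analysis" "HOL-Computational_Algebra.Primes"
begin

text \<open>
  A Dirichlet series is represented by its coefficient sequence, indexed by \<open>n \<ge> 1\<close>; the
  unused value at index \<open>0\<close> is fixed to be \<open>0\<close> so that equality of elements of the type is
  equality of Dirichlet series.
\<close>

typedef h2 = "{a :: nat \<Rightarrow> complex. a 0 = 0 \<and> summable (\<lambda>n. (norm (a n))\<^sup>2)}"
  morphisms h2_coeff Abs_h2
proof
  show "(\<lambda>_. 0) \<in> {a :: nat \<Rightarrow> complex. a 0 = 0 \<and> summable (\<lambda>n. (norm (a n))\<^sup>2)}"
    by simp
qed

setup_lifting type_definition_h2

lemma norm_plus_power2_le: "(norm (x + y :: complex))\<^sup>2 \<le> 2 * (norm x)\<^sup>2 + 2 * (norm y)\<^sup>2"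
proof -
  have "(norm (x + y))\<^sup>2 \<le> (norm x + norm y)\<^sup>2"
    by (intro power_mono norm_triangle_ineq norm_ge_zero)
  also have "\<dots> \<le> 2 * (norm x)\<^sup>2 + 2 * (norm y)\<^sup>2"
    using sum_squares_bound[of "norm x" "norm y"] by (simp add: power2_sum)
  finally show ?thesis .
qed

lemma summable_norm_power2_plus:
  fixes a b :: "nat \<Rightarrow> complex"
  assumes "summable (\<lambda>n. (norm (a n))\<^sup>2)" "summable (\<lambda>n. (norm (b n))\<^sup>2)"
  shows "summable (\<lambda>n. (norm (a n + b n))\<^sup>2)"
proof (rule summable_comparison_test'[where N = 0])
  show "summable (\<lambda>n. 2 * (norm (a n))\<^sup>2 + 2 * (norm (b n))\<^sup>2)"
    using assms by (intro summable_add summable_mult)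
  show "norm ((norm (a n + b n))\<^sup>2) \<le> 2 * (norm (a n))\<^sup>2 + 2 * (norm (b n))\<^sup>2" for n
    using norm_plus_power2_le[of "a n" "b n"] by simp
qed

instantiation h2 :: real_vector
begin

lift_definition zero_h2 :: h2 is "\<lambda>_. 0" by simp

lift_definition plus_h2 :: "h2 \<Rightarrow> h2 \<Rightarrow> h2" is "\<lambda>a b n. a n + b n"
  by (auto intro: summable_norm_power2_plus)

lift_definition uminus_h2 :: "h2 \<Rightarrow> h2" is "\<lambda>a n. - a n" by simp

lift_definition minus_h2 :: "h2 \<Rightarrow> h2 \<Rightarrow> h2" is "\<lambda>a b n. a n - b n"
  using summable_norm_power2_plus[of _ "\<lambda>n. - b n" for b] by fastforce

lift_definition scaleR_h2 :: "real \<Rightarrow> h2 \<Rightarrow> h2" is "\<lambda>c a n. c *\<^sub>R a n"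
  by (simp add: power_mult_distrib summable_mult)

instance
  by standard (transfer; simp add: algebra_simps fun_eq_iff)+

end

lemma h2_summable: "summable (\<lambda>n. (norm (h2_coeff f n))\<^sup>2)"
  using h2_coeff[of f] by simp

lemma h2_summable_inner: "summable (\<lambda>n. inner (h2_coeff f n) (h2_coeff g n))"
proof (rule summable_comparison_test'[where N = 0])
  show "summable (\<lambda>n. (norm (h2_coeff f n))\<^sup>2 + (norm (h2_coeff g n))\<^sup>2)"
    by (intro summable_add h2_summable)
  show "norm (inner (h2_coeff f n) (h2_coeff g n)) \<le>
      (norm (h2_coeff f n))\<^sup>2 + (norm (h2_coeff g n))\<^sup>2" for n
  proof -
    have "\<bar>inner (h2_coeff f n) (h2_coeff g n)\<bar> \<le> norm (h2_coeff f n) * norm (h2_coeff g n)"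
      by (rule Cauchy_Schwarz_ineq2)
    also have "\<dots> \<le> (norm (h2_coeff f n))\<^sup>2 + (norm (h2_coeff g n))\<^sup>2"
      using sum_squares_bound[of "norm (h2_coeff f n)" "norm (h2_coeff g n)"]
        mult_nonneg_nonneg[OF norm_ge_zero[of "h2_coeff f n"] norm_ge_zero[of "h2_coeff g n"]]
      by linarith
    finally show ?thesis by simp
  qed
qed

text \<open>
  The inner product below is the real part of the usual complex inner product
  \<open>\<Sum>n. a n * cnj (b n)\<close>; it induces the same norm.
\<close>

instantiation h2 :: real_inner
begin

definition inner_h2 :: "h2 \<Rightarrow> h2 \<Rightarrow> real" where
  "inner_h2 f g = (\<Sum>n. inner (h2_coeff f n) (h2_coeff g n))"

definition norm_h2 :: "h2 \<Rightarrow> real" where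
  "norm_h2 f = sqrt (\<Sum>n. (norm (h2_coeff f n))\<^sup>2)"

definition sgn_h2 :: "h2 \<Rightarrow> h2" where
  "sgn_h2 f = f /\<^sub>R norm f"

definition dist_h2 :: "h2 \<Rightarrow> h2 \<Rightarrow> real" where
  "dist_h2 f g = norm (f - g)"

definition uniformity_h2 :: "(h2 \<times> h2) filter" where
  "uniformity_h2 = (INF e\<in>{0<..}. principal {(f, g). dist f g < e})"

definition open_h2 :: "h2 set \<Rightarrow> bool" where
  "open_h2 U \<longleftrightarrow> (\<forall>f\<in>U. \<forall>\<^sub>F (f', g) in uniformity. f' = f \<longrightarrow> g \<in> U)"

instance
proof
  fix f g h :: h2 and r :: real and U :: "h2 set"
  show "dist f g = norm (f - g)" by (rule dist_h2_def)
  show "sgn f = f /\<^sub>R norm f" by (rule sgn_h2_def)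
  show "uniformity = (INF e\<in>{0<..}. principal {(f::h2, g). dist f g < e})"
    by (rule uniformity_h2_def)
  show "open U \<longleftrightarrow> (\<forall>f\<in>U. \<forall>\<^sub>F (f', g) in uniformity. f' = f \<longrightarrow> g \<in> U)"
    by (rule open_h2_def)
  show "inner f g = inner g f"
    by (simp add: inner_h2_def inner_commute)
  show "inner (f + g) h = inner f h + inner g h"
    by (simp add: inner_h2_def plus_h2.rep_eq inner_add_left
        suminf_add[OF h2_summable_inner h2_summable_inner])
  show "inner (r *\<^sub>R f) g = r * inner f g"
    by (simp add: inner_h2_def scaleR_h2.rep_eq suminf_mult[OF h2_summable_inner])
  show "0 \<le> inner f f"
    unfolding inner_h2_def by (intro suminf_nonneg h2_summable_inner) simp
  show "inner f f = 0 \<longleftrightarrow> f = 0"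
    unfolding inner_h2_def
    by (subst suminf_eq_zero_iff[OF h2_summable_inner])
      (simp_all add: h2_coeff_inject[symmetric] zero_h2.rep_eq fun_eq_iff)
  show "norm f = sqrt (inner f f)"
    by (simp add: norm_h2_def inner_h2_def power2_norm_eq_inner)
qed

end

text \<open>
  The holomorphic function of a series in \<open>\<H>\<^sup>2\<close>; the series converges absolutely for
  \<open>Re s > 1/2\<close>, and only such \<open>s\<close> are used.
\<close>

definition h2_eval :: "h2 \<Rightarrow> complex \<Rightarrow> complex" where
  "h2_eval f s = (\<Sum>n. h2_coeff f n * of_nat n powr (- s))"

definition volterra_integral :: "h2 \<Rightarrow> h2 \<Rightarrow> complex \<Rightarrow> complex" where
  "volterra_integral g f s =
     - integral {0..} (\<lambda>t. h2_eval f (s + of_real t) * deriv (h2_eval g) (s + of_real t))"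

text \<open>
  The Dirichlet series in \<open>\<H>\<^sup>2\<close> whose sum is the function given by the integral. Such a series is
  unique if it exists, but for an arbitrary symbol \<open>g\<close> it need not exist for every \<open>f\<close>: results
  about this operator have to assert the defining equation.
\<close>

definition volterra :: "h2 \<Rightarrow> h2 \<Rightarrow> h2" where
  "volterra g f = (THE h. \<forall>s. Re s > 1/2 \<longrightarrow> h2_eval h s = volterra_integral g f s)"

definition linear_symbol :: "h2 \<Rightarrow> bool" where
  "linear_symbol g \<longleftrightarrow> (\<forall>n. h2_coeff g n \<noteq> 0 \<longrightarrow> prime n)"

end

theory Submission
  imports Defs "HOL-Complex_Analysis.Complex_Analysis" "HOL-Real_Asymp.Real_Asymp"
begin

text \<open>
  Integrating term by term, \<open>T\<^sub>g f\<close> has the coefficients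
  \<open>c n = (\<Sum>p | n. a (n/p) * b p * ln p) / ln n\<close>. By Cauchy--Schwarz with weights \<open>ln p\<close>, and since the
  primes dividing \<open>n\<close> satisfy \<open>(\<Sum>p | n. ln p) \<le> ln n\<close>, this gives
  \<open>\<bar>c n\<bar>\<^sup>2 \<le> (\<Sum>p | n. \<bar>a (n/p)\<bar>\<^sup>2 * \<bar>b p\<bar>\<^sup>2)\<close>; summing over \<open>n\<close> yields
  \<open>\<parallel>T\<^sub>g f\<parallel> \<le> \<parallel>f\<parallel> * \<parallel>g\<parallel>\<close>. Equality is attained at \<open>f = 1\<close>, as \<open>T\<^sub>g 1 = g\<close>.
\<close>

section \<open>Convolution with a sequence supported on the primes\<close>

text \<open>Dirichlet convolution for a second factor supported on the primes. It is generic in the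
  ring because it is applied to complex coefficients and to their real squared moduli. At 0 the sum
  is empty.\<close>

definition prime_convolution :: "(nat \<Rightarrow> 'a :: semiring_0) \<Rightarrow> (nat \<Rightarrow> 'a) \<Rightarrow> nat \<Rightarrow> 'a" where
  "prime_convolution u v n = (\<Sum>p\<in>prime_factors n. u (n div p) * v p)"

text \<open>The double series over all pairs (m, p) converges absolutely, so it may be regrouped by
  the product n = m * p. The condition \<open>u 0 = 0\<close> discards the pairs with m = 0, which
  would all land on n = 0, where the convolution is an empty sum.\<close>

lemma prime_convolution_sums:
  fixes u v :: "nat \<Rightarrow> 'a :: {real_normed_field, banach}"
  assumes u: "summable (\<lambda>n. norm (u n))" and v: "summable (\<lambda>n. norm (v n))"
    and u0: "u 0 = 0" and prime_supp: "\<And>n. v n \<noteq> 0 \<Longrightarrow> prime n"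
  shows "prime_convolution u v sums (suminf u * suminf v)"
proof -
  let ?w = "\<lambda>(m, p). u m * v p"
  have hs: "(u has_sum suminf u) UNIV" "(v has_sum suminf v) UNIV"
    using u v by (simp_all add: norm_summable_imp_has_sum summable_sums summable_norm_cancel)
  have abs: "(\<lambda>n. norm (u n)) summable_on UNIV" "(\<lambda>n. norm (v n)) summable_on UNIV"
    using u v by (auto intro!: norm_summable_imp_summable_on)
  have "(\<lambda>x. norm (?w x)) summable_on (UNIV \<times> UNIV)"
  proof (rule summable_on_SigmaI)
    show "((\<lambda>p. norm (?w (m, p))) has_sum norm (u m) * infsum (\<lambda>p. norm (v p)) UNIV) UNIV" for m
      using has_sum_cmult_right[OF has_sum_infsum[OF abs(2)]] by (simp add: norm_mult)
    show "(\<lambda>m. norm (u m) * infsum (\<lambda>p. norm (v p)) UNIV) summable_on UNIV"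
      by (rule summable_on_cmult_left[OF abs(1)])
  qed auto
  then have "?w summable_on (UNIV \<times> UNIV)"
    by (rule abs_summable_summable)
  then have "(?w has_sum suminf u * suminf v) (UNIV \<times> UNIV)"
    by (intro has_sum_SigmaI[where g = "\<lambda>m. u m * suminf v"])
      (use has_sum_cmult_right[OF hs(2)] has_sum_cmult_left[OF hs(1)] in auto)
  also have "?this \<longleftrightarrow> (?w has_sum suminf u * suminf v) ({0<..} \<times> {p. prime p})"
    by (intro has_sum_cong_neutral) (use u0 prime_supp in \<open>auto split: prod.splits intro: gr0I\<close>)
  also have "\<dots> \<longleftrightarrow> ((\<lambda>(n, p). u (n div p) * v p) has_sum suminf u * suminf v)
      (Sigma UNIV prime_factors)"
    \<comment> \<open>For positive m and prime p, the map (m, p) to (m * p, p) is a bijection onto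
      the pairs of a number and one of its prime factors.\<close>
    by (rule has_sum_reindex_bij_witness[where i = "\<lambda>(n, p). (n div p, p)" and j = "\<lambda>(m, p). (m * p, p)"])
      (auto simp: in_prime_factors_iff prime_gt_0_nat dvd_imp_le div_greater_zero_iff)
  finally have "(prime_convolution u v has_sum suminf u * suminf v) UNIV"
  proof (rule has_sum_SigmaD)
    show "((\<lambda>p. (case (n, p) of (n, p) \<Rightarrow> u (n div p) * v p)) has_sum prime_convolution u v n)
        (prime_factors n)" for n
      unfolding prime_convolution_def prod.case by (rule has_sum_finite) simp
  qed
  then show ?thesis
    by (rule has_sum_imp_sums)
qed

text \<open>In the prime factorisation of n every occurring exponent is at least 1; take
  logarithms.\<close>

lemma sum_ln_prime_factors_le:
  assumes "n > 0"
  shows "(\<Sum>p\<in>prime_factors n. ln (real p)) \<le> ln (real n)"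
proof -
  have pos: "p > 0" if "p \<in> prime_factors n" for p
    using that by (auto simp: in_prime_factors_iff prime_gt_0_nat)
  have "(\<Sum>p\<in>prime_factors n. ln (real p)) \<le> (\<Sum>p\<in>prime_factors n. ln (real (p ^ multiplicity p n)))"
  proof (rule sum_mono)
    fix p assume p: "p \<in> prime_factors n"
    then have "1 \<le> multiplicity p n"
      by (simp add: prime_factors_multiplicity)
    then show "ln (real p) \<le> ln (real (p ^ multiplicity p n))"
      using pos[OF p] by (simp add: ln_realpow mult_le_cancel_right1)
  qed
  also have "\<dots> = ln (real (\<Prod>p\<in>prime_factors n. p ^ multiplicity p n))"
    using pos by (simp add: ln_prod)
  also have "\<dots> = ln (real n)"
    using assms by (subst prod_prime_factors) auto
  finally show ?thesis .
qed

section \<open>Dirichlet series\<close>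

lemma norm_of_nat_powr: "norm (of_nat n powr s :: complex) = real n powr Re s"
  using norm_powr_real_powr[of "of_nat n" s] by simp

lemma h2_coeff_0 [simp]: "h2_coeff f 0 = 0"
  using h2_coeff[of f] by simp

lemma h2_abs_summable:
  assumes "\<sigma> > 1/2"
  shows "summable (\<lambda>n. norm (h2_coeff f n) * real n powr (-\<sigma>))"
proof (rule summable_comparison_test'[where N = 0])
  show "summable (\<lambda>n. (norm (h2_coeff f n))\<^sup>2 + real n powr (- 2 * \<sigma>))"
    using assms by (intro summable_add h2_summable) (simp add: summable_real_powr_iff)
  show "norm (norm (h2_coeff f n) * real n powr (-\<sigma>)) \<le> (norm (h2_coeff f n))\<^sup>2 + real n powr (- 2 * \<sigma>)" for n
  proof -
    have "real n powr (- 2 * \<sigma>) = (real n powr (-\<sigma>))\<^sup>2"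
      by (simp add: power2_eq_square flip: powr_add)
    moreover have "0 \<le> norm (h2_coeff f n) * real n powr (-\<sigma>)"
      by simp
    ultimately show ?thesis
      using sum_squares_bound[of "norm (h2_coeff f n)" "real n powr (-\<sigma>)"]
      unfolding real_norm_def by linarith
  qed
qed

text \<open>The logarithm costs only an arbitrarily small power of n, which the open condition on
  \<sigma> can absorb.\<close>

lemma h2_abs_summable_ln:
  assumes "\<sigma> > 1/2"
  shows "summable (\<lambda>n. norm (ln (real n) * h2_coeff f n) * real n powr (-\<sigma>))"
proof (rule summable_comparison_test'[where N = 1])
  \<comment> \<open>Half the distance from \<sigma> to 1/2, so that \<sigma> - \<epsilon> still
    exceeds 1/2.\<close>
  define \<epsilon> where "\<epsilon> = (\<sigma> - 1/2) / 2"
  have \<epsilon>: "\<epsilon> > 0" "\<sigma> - \<epsilon> > 1/2"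
    using assms by (auto simp: \<epsilon>_def field_simps)
  show "summable (\<lambda>n. (1 / \<epsilon>) * (norm (h2_coeff f n) * real n powr (-(\<sigma> - \<epsilon>))))"
    by (intro summable_mult h2_abs_summable \<epsilon>)
  show "norm (norm (ln (real n) * h2_coeff f n) * real n powr (-\<sigma>))
      \<le> (1 / \<epsilon>) * (norm (h2_coeff f n) * real n powr (-(\<sigma> - \<epsilon>)))" if "n \<ge> 1" for n
  proof -
    have "norm (norm (ln (real n) * h2_coeff f n) * real n powr (-\<sigma>))
        = ln (real n) * (norm (h2_coeff f n) * real n powr (-\<sigma>))"
      using that by (simp add: norm_mult abs_mult)
    also have "\<dots> \<le> (real n powr \<epsilon> / \<epsilon>) * (norm (h2_coeff f n) * real n powr (-\<sigma>))"
      using that \<epsilon> by (intro mult_right_mono ln_powr_bound) auto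
    also have "\<dots> = (1 / \<epsilon>) * (norm (h2_coeff f n) * real n powr (-(\<sigma> - \<epsilon>)))"
      by (simp add: powr_diff powr_minus field_simps)
    finally show ?thesis .
  qed
qed

text \<open>Termwise differentiation, justified by a summable majorant near each point of the
  half-plane.\<close>

lemma h2_eval_has_field_derivative:
  assumes s: "Re s > 1/2"
  shows "(h2_eval f has_field_derivative
      (\<Sum>n. - (ln (real n) * h2_coeff f n) * of_nat n powr (- s))) (at s)"
proof -
  define S where "S = {s. Re s > 1/2}"
  let ?f = "\<lambda>n s. h2_coeff f n * of_nat n powr (- s)"
  let ?f' = "\<lambda>n s. - (ln (real n) * h2_coeff f n) * of_nat n powr (- s)"
  have "open S"
    unfolding S_def by (rule open_halfspace_Re_gt)
  have "\<exists>g g'. \<forall>x\<in>S. (\<lambda>n. ?f n x) sums g x \<and> (\<lambda>n. ?f' n x) sums g' x \<and>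
      (g has_field_derivative g' x) (at x)"
  proof (rule series_and_derivative_comparison_local[OF \<open>open S\<close>])
    fix n x assume "x \<in> S"
    show "(?f n has_field_derivative ?f' n x) (at x)"
    proof (cases "n = 0")
      case False
      then show ?thesis
        by (auto intro!: derivative_eq_intros DERIV_chain2[OF has_field_derivative_powr_right] simp: Ln_of_nat)
    qed auto
  next
    fix x assume x: "x \<in> S"
    \<comment> \<open>Half the distance from x to the boundary line: the ball of radius d stays to
      the right of \<open>Re x - d > 1/2\<close>, so one majorant serves all its points.\<close>
    define d where "d = (Re x - 1/2) / 2"
    have d: "d > 0" "Re x - d > 1/2"
      using x by (auto simp: d_def S_def field_simps)
    have "norm (?f n y) \<le> norm (h2_coeff f n) * real n powr (- (Re x - d))"
      if "y \<in> ball x d \<inter> S" for n y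
    proof -
      have "\<bar>Re (x - y)\<bar> < d"
        using that abs_Re_le_cmod[of "x - y"] by (auto simp: dist_norm)
      then have "real n powr (- Re y) \<le> real n powr (- (Re x - d))"
        by (cases "n = 0") (auto intro!: powr_mono)
      then show ?thesis
        by (simp add: norm_mult norm_of_nat_powr mult_left_mono)
    qed
    then show "\<exists>d h. 0 < d \<and> summable h \<and>
        (\<forall>\<^sub>F n in sequentially. \<forall>y\<in>ball x d \<inter> S. norm (?f n y) \<le> h n)"
      using d h2_abs_summable[OF d(2), of f] by (intro exI[of _ d] exI conjI) auto
  qed
  then obtain g g' where g: "\<And>x. x \<in> S \<Longrightarrow> (\<lambda>n. ?f n x) sums g x"
      "\<And>x. x \<in> S \<Longrightarrow> (\<lambda>n. ?f' n x) sums g' x"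
      "\<And>x. x \<in> S \<Longrightarrow> (g has_field_derivative g' x) (at x)"
    by blast
  have s: "s \<in> S"
    using s by (simp add: S_def)
  have "(h2_eval f has_field_derivative g' s) (at s)"
    using g(3)[OF s] \<open>open S\<close> s
    by (rule has_field_derivative_transform_within_open) (use g(1) in \<open>auto simp: h2_eval_def sums_iff\<close>)
  then show ?thesis
    using g(2)[OF s] by (simp add: sums_iff)
qed

text \<open>Without a constant term the series effectively starts at n = 2, where n^(-t) is at most
  2^(-t). This decay later gives both the limit at infinity and the integrable majorant.\<close>

lemma norm_dirichlet_series_le:
  fixes a :: "nat \<Rightarrow> complex"
  assumes sum: "summable (\<lambda>n. norm (a n) * real n powr (-Re s))" and "a 1 = 0" and "t \<ge> 0"
  shows "norm (\<Sum>n. a n * of_nat n powr (- (s + of_real t)))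
      \<le> (\<Sum>n. norm (a n) * real n powr (-Re s)) * 2 powr (-t)"
proof -
  have le: "norm (a n * of_nat n powr (- (s + of_real t)))
      \<le> norm (a n) * real n powr (-Re s) * 2 powr (-t)" for n
  proof (cases "n < 2")
    case True
    then have "n = 0 \<or> n = 1"
      by auto
    then show ?thesis
      using assms by auto
  next
    case False
    then have "real n powr (-t) \<le> 2 powr (-t)"
      using \<open>t \<ge> 0\<close> by (intro powr_mono2') auto
    then show ?thesis
      using powr_add[of "real n" "- Re s" "- t"]
      by (simp add: norm_mult norm_of_nat_powr mult.assoc mult_left_mono)
  qed
  have "norm (\<Sum>n. a n * of_nat n powr (- (s + of_real t)))
      \<le> (\<Sum>n. norm (a n) * real n powr (-Re s) * 2 powr (-t))"
    by (rule norm_suminf_le[OF le summable_mult2[OF sum]])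
  then show ?thesis
    by (simp add: suminf_mult2[OF sum])
qed

text \<open>Coefficients are recovered one at a time from the values at integers k: multiply the
  series of the difference by N^k and let k tend to infinity. Terms with n < N vanish by induction,
  those with n > N tend to 0, and coefficient N remains.\<close>

lemma h2_eval_inject:
  assumes "\<And>s. Re s > 1/2 \<Longrightarrow> h2_eval f s = h2_eval g s"
  shows "f = g"
proof -
  define h where "h = f - g"
  have h0: "h2_eval h s = 0" if "Re s > 1/2" for s
  proof -
    have summable: "summable (\<lambda>n. h2_coeff k n * of_nat n powr (-s))" for k
      using h2_abs_summable[OF that, of k]
      by - (rule summable_norm_cancel, simp add: norm_mult norm_of_nat_powr)
    show ?thesis
      using suminf_diff[OF summable summable, of f g] assms[OF that]
      by (simp add: h_def h2_eval_def minus_h2.rep_eq algebra_simps)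
  qed
  have "h2_coeff h N = 0" for N
  proof (induction N rule: less_induct)
    case (less N)
    show ?case
    proof (cases "N = 0")
      case False
      let ?t = "\<lambda>n k. h2_coeff h n * (of_nat N / of_nat n) ^ k"
      let ?l = "\<lambda>n. if n = N then h2_coeff h N else 0"
      have "(?t n \<longlongrightarrow> ?l n) sequentially" for n
      proof -
        consider "n < N" | "n = N" | "n > N"
          by linarith
        then show ?thesis
        proof cases
          case 3
          then have "(\<lambda>k. (of_nat N / of_nat n :: complex) ^ k) \<longlonglongrightarrow> 0"
            by (intro LIMSEQ_power_zero) (simp add: norm_divide)
          then show ?thesis
            using 3 tendsto_mult_left[of _ 0 sequentially "h2_coeff h n"] by auto
        qed (use False less in auto)
      qed
      \<comment> \<open>The majorant for Tannery's theorem: for n \<ge> N the ratio N/n is at most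
        1, so its powers are bounded by the first one, which yields N times the absolute series at
        \<sigma> = 1.\<close>
      moreover have "norm (?t n k) \<le> norm (h2_coeff h n) * real n powr (-1) * real N" if "k \<ge> 1" for n k
      proof (cases "n < N \<or> n = 0")
        case True
        then show ?thesis
          using less by auto
      next
        case n: False
        have "norm (?t n k) = norm (h2_coeff h n) * (real N / real n) ^ k"
          by (simp add: norm_mult norm_power norm_divide)
        also have "\<dots> \<le> norm (h2_coeff h n) * (real N / real n) ^ 1"
          using n that by (intro mult_left_mono power_decreasing) auto
        also have "\<dots> = norm (h2_coeff h n) * real n powr (-1) * real N"
          using n by (simp add: powr_minus_divide)
        finally show ?thesis .
      qed
      then have "eventually (\<lambda>(n, k). norm (?t n k) \<le> norm (h2_coeff h n) * real n powr (-1) * real N)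
          (at_top \<times>\<^sub>F sequentially)"
        by (intro eventually_prod_sequentially[THEN iffD2] exI[of _ 1]) auto
      moreover have "summable (\<lambda>n. norm (h2_coeff h n) * real n powr (-1) * real N)"
        by (intro summable_mult2 h2_abs_summable) simp
      ultimately have "((\<lambda>k. suminf (\<lambda>n. ?t n k)) \<longlongrightarrow> suminf ?l) sequentially"
        by (intro tannerys_theorem[THEN conjunct2, THEN conjunct2]) simp_all
      moreover have "suminf ?l = h2_coeff h N"
        by (subst suminf_finite[of "{N}"]) auto
      moreover have "suminf (\<lambda>n. ?t n k) = 0" if "k \<ge> 1" for k
      proof -
        \<comment> \<open>After factoring out \<open>N ^ k\<close>, this is the series of \<open>h\<close> at \<open>s = k\<close>.\<close>
        have eq: "?t n k = of_nat N ^ k * (h2_coeff h n * of_nat n powr (- of_nat k))" for n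
          by (cases "n = 0") (auto simp: powr_minus field_simps)
        have "summable (\<lambda>n. h2_coeff h n * of_nat n powr (- of_nat k))"
          using h2_abs_summable[of "real k" h] that
          by - (rule summable_norm_cancel, simp add: norm_mult norm_of_nat_powr)
        then show ?thesis
          unfolding eq using h0[of "of_nat k"] that by (simp add: suminf_mult h2_eval_def)
      qed
      then have "(\<lambda>k. suminf (\<lambda>n. ?t n k)) \<longlonglongrightarrow> 0"
        by (intro tendsto_eventually eventually_sequentiallyI[of 1]) auto
      ultimately show ?thesis
        using LIMSEQ_unique by metis
    qed simp
  qed
  then have "h = 0"
    by (simp add: h2_coeff_inject[symmetric] zero_h2.rep_eq fun_eq_iff)
  then show ?thesis
    by (simp add: h_def)
qed

text \<open>Apply the fundamental theorem on bounded intervals and pass to the limit by dominated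
  convergence.\<close>

lemma has_integral_FTC_at_top:
  fixes F f :: "real \<Rightarrow> 'a :: euclidean_space"
  assumes F: "\<And>t. t \<ge> a \<Longrightarrow> (F has_vector_derivative f t) (at t within {a..})"
    and lim: "(F \<longlongrightarrow> L) at_top"
    and B: "B integrable_on {a..}" "\<And>t. t \<ge> a \<Longrightarrow> norm (f t) \<le> B t"
  shows "(f has_integral (L - F a)) {a..}"
proof -
  \<comment> \<open>Truncation by zero keeps the domain of integration fixed, as dominated
    convergence requires.\<close>
  define f' where "f' k t = (if t \<in> {a..a + real k} then f t else 0)" for k t
  have f': "(f' k has_integral (F (a + real k) - F a)) {a..}" for k
  proof -
    have "(f has_integral (F (a + real k) - F a)) {a..a + real k}"
      by (rule fundamental_theorem_of_calculus)
        (auto intro: has_vector_derivative_within_subset[OF F])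
    then show ?thesis
      unfolding f'_def by (subst has_integral_restrict) auto
  qed
  have le: "norm (f' k t) \<le> B t" if "t \<in> {a..}" for k t
    using B(2)[of t] norm_ge_zero[of "f t"] that by (auto simp: f'_def simp del: norm_ge_zero)
  have conv: "(\<lambda>k. f' k t) \<longlonglongrightarrow> f t" if "t \<in> {a..}" for t
  proof (rule tendsto_eventually)
    obtain N where "t - a \<le> real N"
      using real_arch_simple by blast
    then show "\<forall>\<^sub>F k in sequentially. f' k t = f t"
      using that by (intro eventually_sequentiallyI[of N]) (auto simp: f'_def)
  qed
  have "f integrable_on {a..}" "(\<lambda>k. integral {a..} (f' k)) \<longlonglongrightarrow> integral {a..} f"
    using dominated_convergence[of f' "{a..}" B f] f' B(1) le conv by blast+
  moreover have "(\<lambda>k. F (a + real k) - F a) \<longlonglongrightarrow> L - F a"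
    by (intro tendsto_intros filterlim_compose[OF lim])
      (auto intro!: filterlim_tendsto_add_at_top tendsto_const filterlim_real_sequentially)
  ultimately have "integral {a..} f = L - F a"
    using LIMSEQ_unique by (simp add: integral_unique[OF f'])
  with \<open>f integrable_on {a..}\<close> show ?thesis
    by (simp add: has_integral_iff)
qed

section \<open>The Volterra operator with a linear symbol\<close>

text \<open>The weights \<open>ln p\<close> come from differentiating g, the divisor
  \<open>ln n\<close> from integrating n^(-s). At n = 0 and n = 1 the sum is empty and the value is
  0, so there is no constant term.\<close>

definition volterra_coeff :: "h2 \<Rightarrow> h2 \<Rightarrow> nat \<Rightarrow> complex" where
  "volterra_coeff g f n =
     prime_convolution (h2_coeff f) (\<lambda>p. ln (real p) * h2_coeff g p) n / ln (real n)"

lemma ln_volterra_coeff: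
  "ln (real n) * volterra_coeff g f n =
     prime_convolution (h2_coeff f) (\<lambda>p. ln (real p) * h2_coeff g p) n"
proof (cases "n \<le> 1")
  case True
  then have "n = 0 \<or> n = 1"
    by auto
  then show ?thesis
    by (auto simp: prime_convolution_def)
qed (simp add: volterra_coeff_def)

lemma norm_volterra_coeff_le:
  "(norm (volterra_coeff g f n))\<^sup>2 \<le>
     prime_convolution (\<lambda>m. (norm (h2_coeff f m))\<^sup>2) (\<lambda>p. (norm (h2_coeff g p))\<^sup>2) n"
proof (cases "n \<le> 1")
  case True
  then have "n = 0 \<or> n = 1"
    by auto
  then show ?thesis
    by (auto simp: prime_convolution_def volterra_coeff_def)
next
  case False
  let ?P = "prime_factors n"
  let ?x = "\<lambda>p. norm (h2_coeff f (n div p)) * norm (h2_coeff g p)"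
  have ln: "ln (real n) > 0"
    using False by simp
  have p: "0 \<le> ln (real p)" "ln (real p) \<le> ln (real n)" if "p \<in> ?P" for p
    using that False
    by (auto simp: in_prime_factors_iff dvd_imp_le prime_ge_1_nat prime_gt_0_nat Suc_le_eq)
  have "(ln (real n) * norm (volterra_coeff g f n))\<^sup>2
      = (norm (prime_convolution (h2_coeff f) (\<lambda>p. ln (real p) * h2_coeff g p) n))\<^sup>2"
    using ln by (simp add: norm_mult flip: ln_volterra_coeff)
  \<comment> \<open>Each weight \<open>ln p\<close> is split into two square roots, one for each
    factor of Cauchy-Schwarz.\<close>
  also have "\<dots> \<le> (\<Sum>p\<in>?P. sqrt (ln (real p)) * (sqrt (ln (real p)) * ?x p))\<^sup>2"
    unfolding prime_convolution_def
    by (intro power_mono sum_norm_le) (use p(1) in \<open>auto simp: norm_mult mult.assoc[symmetric]\<close>)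
  also have "\<dots> \<le> (\<Sum>p\<in>?P. (sqrt (ln (real p)))\<^sup>2) * (\<Sum>p\<in>?P. (sqrt (ln (real p)) * ?x p)\<^sup>2)"
    by (rule Cauchy_Schwarz_ineq_sum)
  also have "\<dots> = (\<Sum>p\<in>?P. ln (real p)) * (\<Sum>p\<in>?P. ln (real p) * (?x p)\<^sup>2)"
    using p(1) by (simp add: power_mult_distrib)
  \<comment> \<open>The first factor uses the bound on the whole sum of logarithms, the second only
    \<open>ln p \<le> ln n\<close> for each p. The resulting square of \<open>ln n\<close> cancels
    the divisor in the coefficient.\<close>
  also have "\<dots> \<le> ln (real n) * (\<Sum>p\<in>?P. ln (real n) * (?x p)\<^sup>2)"
    using p False ln
    by (intro mult_mono sum_ln_prime_factors_le sum_mono mult_right_mono sum_nonneg mult_nonneg_nonneg) auto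
  also have "\<dots> = (ln (real n))\<^sup>2 *
      prime_convolution (\<lambda>m. (norm (h2_coeff f m))\<^sup>2) (\<lambda>p. (norm (h2_coeff g p))\<^sup>2) n"
    by (simp add: prime_convolution_def power_mult_distrib power2_eq_square sum_distrib_left mult_ac)
  finally show ?thesis
    using ln by (simp add: power_mult_distrib)
qed

lemma norm_h2_power2: "(norm f)\<^sup>2 = (\<Sum>n. (norm (h2_coeff f n))\<^sup>2)"
  unfolding norm_h2_def by (simp add: suminf_nonneg h2_summable)

text \<open>\<open>Abs_h2\<close> is meaningful here only if the coefficients are square-summable,
  which is proved below for linear symbols.\<close>

definition volterra_series :: "h2 \<Rightarrow> h2 \<Rightarrow> h2" where
  "volterra_series g f = Abs_h2 (volterra_coeff g f)"

text \<open>The constant function 1, the unit vector at which the operator norm is attained.\<close>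

lift_definition h2_one :: h2 is "\<lambda>n. if n = 1 then 1 else 0"
  by (auto intro!: summable_finite[of "{1}"] split: if_splits)

lemma norm_h2_one: "norm h2_one = 1"
proof -
  have "(\<Sum>n. (norm (h2_coeff h2_one n))\<^sup>2) = (\<Sum>n\<in>{1}. (norm (h2_coeff h2_one n))\<^sup>2)"
    by (rule suminf_finite) (auto simp: h2_one.rep_eq)
  then show ?thesis
    by (simp add: norm_h2_def h2_one.rep_eq)
qed

section \<open>Boundedness, integral formula and norm for a fixed linear symbol\<close>

context
  fixes g :: h2
  assumes g: "linear_symbol g"
begin

text \<open>The product formula for squared moduli: it evaluates the sum of the pointwise bounds on
  the coefficients.\<close>

lemma norm_power2_convolution_sums:
  "prime_convolution (\<lambda>m. (norm (h2_coeff f m))\<^sup>2) (\<lambda>p. (norm (h2_coeff g p))\<^sup>2)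
     sums ((norm f)\<^sup>2 * (norm g)\<^sup>2)"
  unfolding norm_h2_power2
  using g by (intro prime_convolution_sums) (auto simp: h2_summable linear_symbol_def)

lemma volterra_coeff_summable: "summable (\<lambda>n. (norm (volterra_coeff g f n))\<^sup>2)"
  by (rule summable_comparison_test'[OF sums_summable[OF norm_power2_convolution_sums[of f]]])
    (use norm_volterra_coeff_le in auto)

lemma h2_coeff_volterra_series: "h2_coeff (volterra_series g f) = volterra_coeff g f"
  unfolding volterra_series_def
  by (subst Abs_h2_inverse) (auto simp: volterra_coeff_summable, simp add: volterra_coeff_def)

lemma norm_volterra_series_le: "norm (volterra_series g f) \<le> norm f * norm g"
proof -
  have "(norm (volterra_series g f))\<^sup>2 \<le> (norm f * norm g)\<^sup>2"
    unfolding norm_h2_power2[of "volterra_series g f"] h2_coeff_volterra_series power_mult_distrib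
    using norm_power2_convolution_sums[of f] volterra_coeff_summable norm_volterra_coeff_le
    by (simp add: sums_iff) (metis suminf_le)
  then show ?thesis
    by (rule power2_le_imp_le) simp
qed

text \<open>Multiplying the series of f and g' gives a prime convolution whose n-th coefficient is
  \<open>- ln n\<close> times that of \<open>volterra_series g f\<close>, hence the termwise
  derivative.\<close>

lemma h2_eval_volterra_series_deriv:
  assumes s: "Re s > 1/2"
  shows "(h2_eval (volterra_series g f) has_field_derivative h2_eval f s * deriv (h2_eval g) s) (at s)"
proof -
  let ?u = "\<lambda>n. h2_coeff f n * of_nat n powr (- s)"
  let ?v = "\<lambda>n. - (ln (real n) * h2_coeff g n) * of_nat n powr (- s)"
  have "prime_convolution ?u ?v sums (suminf ?u * suminf ?v)"
    using h2_abs_summable[OF s, of f] h2_abs_summable_ln[OF s, of g] g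
    by (intro prime_convolution_sums) (auto simp: norm_mult norm_of_nat_powr linear_symbol_def)
  also have "suminf ?u * suminf ?v = h2_eval f s * deriv (h2_eval g) s"
    using DERIV_imp_deriv[OF h2_eval_has_field_derivative[OF s, of g]] by (simp add: h2_eval_def)
  also have "prime_convolution ?u ?v =
      (\<lambda>n. - (ln (real n) * h2_coeff (volterra_series g f) n) * of_nat n powr (- s))"
  proof
    fix n
    \<comment> \<open>Complete multiplicativity of n^(-s) lets the power of n be pulled out of the
      convolution.\<close>
    have "of_nat n powr (- s) = of_nat (n div p) powr (- s) * (of_nat p powr (- s) :: complex)"
      if "p \<in> prime_factors n" for p
    proof -
      have "n = n div p * p"
        using that by (simp add: in_prime_factors_iff)
      then have "of_nat n powr (- s) = (of_nat (n div p) * of_nat p :: complex) powr (- s)"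
        by (metis of_nat_mult)
      then show ?thesis
        by (simp add: powr_times_real)
    qed
    then show "prime_convolution ?u ?v n =
        - (ln (real n) * h2_coeff (volterra_series g f) n) * of_nat n powr (- s)"
      unfolding h2_coeff_volterra_series ln_volterra_coeff prime_convolution_def
        sum_negf[symmetric] sum_distrib_right
      by (intro sum.cong) (simp_all add: mult_ac)
  qed
  finally show ?thesis
    using h2_eval_has_field_derivative[OF s, of "volterra_series g f"] by (simp add: sums_iff)
qed

text \<open>Along the half-line the series is an antiderivative of the integrand that vanishes at
  infinity, so only its value at s remains.\<close>

lemma h2_eval_volterra_series:
  assumes s: "Re s > 1/2"
  shows "h2_eval (volterra_series g f) s = volterra_integral g f s"
proof -
  let ?h = "volterra_series g f"
  have h1: "h2_coeff ?h 1 = 0"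
    by (simp add: h2_coeff_volterra_series volterra_coeff_def)
  define B where "B = (\<Sum>n. norm (ln (real n) * h2_coeff ?h n) * real n powr (- Re s))"
  define C where "C = (\<Sum>n. norm (h2_coeff ?h n) * real n powr (- Re s))"
  have "((\<lambda>t. h2_eval f (s + of_real t) * deriv (h2_eval g) (s + of_real t))
      has_integral (0 - h2_eval ?h (s + of_real 0))) {0..}"
  proof (rule has_integral_FTC_at_top)
    fix t :: real assume t: "t \<ge> 0"
    then have st: "Re (s + of_real t) > 1/2"
      using s by simp
    have "((\<lambda>t. s + of_real t) has_vector_derivative 1) (at t within {0..})"
      by (auto intro!: derivative_eq_intros)
    from field_vector_diff_chain_within[OF this
        has_field_derivative_at_within[OF h2_eval_volterra_series_deriv[OF st, of f]]]
    show "((\<lambda>t. h2_eval ?h (s + of_real t)) has_vector_derivative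
        h2_eval f (s + of_real t) * deriv (h2_eval g) (s + of_real t)) (at t within {0..})"
      by (simp add: o_def)
    \<comment> \<open>The integrand equals a termwise derivative; since \<open>ln 1 = 0\<close> it
      has no constant term and so decays like 2^(-t).\<close>
    have "h2_eval f (s + of_real t) * deriv (h2_eval g) (s + of_real t)
        = (\<Sum>n. - (ln (real n) * h2_coeff ?h n) * of_nat n powr (- (s + of_real t)))"
      using h2_eval_volterra_series_deriv[OF st] h2_eval_has_field_derivative[OF st]
      by (rule DERIV_unique)
    also have "norm \<dots> \<le> B * 2 powr (- t)"
      using norm_dirichlet_series_le[of "\<lambda>n. - (ln (real n) * h2_coeff ?h n)" s t] t
        h2_abs_summable_ln[OF s, of ?h] by (simp add: B_def)
    finally show "norm (h2_eval f (s + of_real t) * deriv (h2_eval g) (s + of_real t))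
        \<le> B * 2 powr (- t)" .
  next
    have "(\<lambda>t. exp (- ln 2 * t)) integrable_on {0::real..}"
      by (intro integrable_on_exp_minus_to_infinity) simp
    then show "(\<lambda>t. B * 2 powr (- t)) integrable_on {0::real..}"
      by (intro integrable_on_mult_right) (simp add: powr_def mult.commute)
  next
    have "((\<lambda>t::real. C * 2 powr (- t)) \<longlongrightarrow> C * 0) at_top"
      by (intro tendsto_intros) real_asymp
    then have lim: "((\<lambda>t::real. C * 2 powr (- t)) \<longlongrightarrow> 0) at_top"
      by simp
    have "norm (h2_eval ?h (s + of_real t)) \<le> C * 2 powr (- t)" if "t \<ge> 0" for t
      unfolding C_def h2_eval_def
      using h2_abs_summable[OF s] h1 that by (rule norm_dirichlet_series_le)
    then show "((\<lambda>t. h2_eval ?h (s + of_real t)) \<longlongrightarrow> 0) at_top"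
      by (intro Lim_null_comparison[OF _ lim] eventually_at_top_linorderI)
  qed
  then show ?thesis
    unfolding volterra_integral_def by (simp add: integral_unique)
qed

text \<open>The integral formula gives existence and \<open>h2_eval_inject\<close> gives uniqueness,
  which resolves the definite description.\<close>

lemma volterra_eq_volterra_series: "volterra g f = volterra_series g f"
  unfolding volterra_def
  by (rule the_equality) (auto simp: h2_eval_volterra_series intro!: h2_eval_inject)

lemma bounded_linear_volterra_series: "bounded_linear (volterra_series g)"
proof (rule bounded_linear_intro)
  show "volterra_series g (f + h) = volterra_series g f + volterra_series g h" for f h
    by (simp add: h2_coeff_inject[symmetric] plus_h2.rep_eq h2_coeff_volterra_series fun_eq_iff
        volterra_coeff_def prime_convolution_def algebra_simps sum.distrib add_divide_distrib)
  show "volterra_series g (r *\<^sub>R f) = r *\<^sub>R volterra_series g f" for r f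
    by (simp add: h2_coeff_inject[symmetric] scaleR_h2.rep_eq h2_coeff_volterra_series fun_eq_iff
        volterra_coeff_def prime_convolution_def sum_distrib_left scaleR_conv_of_real mult.assoc)
qed (rule norm_volterra_series_le)

lemma volterra_series_one: "volterra_series g h2_one = g"
proof -
  have "volterra_coeff g h2_one n = h2_coeff g n" for n
  proof -
    \<comment> \<open>Only the coefficient of \<open>h2_one\<close> at 1 is nonzero, so the sole
      surviving term is p = n, present exactly when n is prime; then \<open>ln n\<close> cancels.
      For other n both sides are 0.\<close>
    have "n div p = 1 \<longleftrightarrow> p = n" if "p \<in> prime_factors n" for p
      using that by (auto simp: in_prime_factors_iff elim!: dvdE)
    then have "prime_convolution (h2_coeff h2_one) (\<lambda>p. ln (real p) * h2_coeff g p) n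
        = (\<Sum>p\<in>prime_factors n. if p = n then ln (real n) * h2_coeff g n else 0)"
      unfolding prime_convolution_def by (intro sum.cong) (auto simp: h2_one.rep_eq)
    also have "\<dots> = (if prime n then ln (real n) * h2_coeff g n else 0)"
      by (auto simp: in_prime_factors_iff)
    finally show ?thesis
      using g prime_gt_1_nat[of n] by (auto simp: volterra_coeff_def linear_symbol_def)
  qed
  then show ?thesis
    by (simp add: h2_coeff_inject[symmetric] h2_coeff_volterra_series fun_eq_iff)
qed

lemma onorm_volterra_series: "onorm (volterra_series g) = norm g"
proof (rule antisym)
  show "onorm (volterra_series g) \<le> norm g"
    using norm_volterra_series_le by (intro onorm_bound) (auto simp: mult.commute)
  show "norm g \<le> onorm (volterra_series g)"
    using onorm[OF bounded_linear_volterra_series, of h2_one] by (simp add: volterra_series_one norm_h2_one)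
qed

end

theorem theorem4p1:
  fixes g :: h2
  assumes "linear_symbol g"
  shows "(\<forall>f s. Re s > 1/2 \<longrightarrow> h2_eval (volterra g f) s = volterra_integral g f s) \<and>
         bounded_linear (volterra g) \<and>
         onorm (volterra g) = norm g"
proof -
  have "volterra g = volterra_series g"
    using volterra_eq_volterra_series[OF assms] by (rule ext)
  then show ?thesis
    by (simp add: assms h2_eval_volterra_series bounded_linear_volterra_series onorm_volterra_series)
qed

end
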